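(* Let $\mathfrak{e}\subset\mathbb{R}$ be an infinite compact set, $x_-=\inf\mathfrak{e}$, $x_+=\sup\mathfrak{e}$, and $n\in\mathbb{N}$. The dual residual polynomials $\widetilde{R}_{x_0,n}$ of $\mathfrak{e}$ do not change as $x_0$ varies through the same connected component of $\mathbb{R}\setminus\mathfrak{e}$, and if $x_0\in(-\infty,x_-)\cup(x_+,\infty)$ then $\widetilde{R}_{x_0,n}$ is equal, up to a constant factor, to the Chebyshev polynomial $T_n$ of $\mathfrak{e}$ (of the same order $n$). Equivalently to the first assertion, if $x_0,y_0$ are in the same connected component of $\mathbb{R}\setminus\mathfrak{e}$, then $$R_{y_0,n}(x)=R_{x_0,n}(x)/R_{x_0,n}(y_0).$$
   Context: $\|f\|_{\mathfrak{e}}=\sup_{z\in\mathfrak{e}}|f(z)|$. For $x_0\in\mathbb{R}\setminus\mathfrak{e}$, the residual polynomial $R_{x_0,n}$ is the unique polynomial minimizing $\|P\|_{\mathfrak{e}}$ among all polynomials $P$ of degree at most $n$ with $P(x_0)=1$. The dual residual polynomial $\widetilde R_{x_0,n}=R_{x_0,n}/\|R_{x_0,n}\|_{\mathfrak{e}}$ is the polynomial maximizing $P(x_0)$ among polynomials of degree at most $n$ with $\|P\|_{\mathfrak{e}}=1$. The Chebyshev polynomial $T_n$ of $\mathfrak{e}$ is the unique monic polynomial of degree $n$ minimizing $\|\cdot\|_{\mathfrak{e}}$ among monic polynomials of degree $n$. *)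

theory Defs
  imports "HOL-Analysis.Analysis" "HOL-Computational_Algebra.Polynomial"
begin

text \<open>
  Polynomials have complex coefficients, as in the general theory of extremal polynomials;
  the set on which the norm is taken and the normalization point are real.
\<close>

definition poly_supnorm :: "real set \<Rightarrow> complex poly \<Rightarrow> real" where
  "poly_supnorm E P = (SUP x\<in>E. norm (poly P (complex_of_real x)))"

text \<open>
  For infinite compact \<open>E\<close> (and \<open>x0 \<notin> E\<close>) the minimizers below exist and are unique,
  so the definite descriptions denote them.
\<close>

definition residual_poly :: "real set \<Rightarrow> real \<Rightarrow> nat \<Rightarrow> complex poly" where
  "residual_poly E x0 n =
     (THE P. is_arg_min (poly_supnorm E)
               (\<lambda>P. degree P \<le> n \<and> poly P (complex_of_real x0) = 1) P)"

definition dual_residual_poly :: "real set \<Rightarrow> real \<Rightarrow> nat \<Rightarrow> complex poly" where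
  "dual_residual_poly E x0 n =
     smult (complex_of_real (1 / poly_supnorm E (residual_poly E x0 n))) (residual_poly E x0 n)"

definition chebyshev_poly :: "real set \<Rightarrow> nat \<Rightarrow> complex poly" where
  "chebyshev_poly E n =
     (THE P. is_arg_min (poly_supnorm E) (\<lambda>P. degree P = n \<and> lead_coeff P = 1) P)"

end

theory Submission
  imports Defs
begin

text \<open>
  Among all sets \<open>A\<close> of \<open>n + 1\<close> nodes in \<open>E\<close>, pick one minimizing the Lebesgue function
  \<open>\<Lambda>\<close> (the sum of the absolute values of the Lagrange basis polynomials) at \<open>x0\<close>. Let \<open>R\<close>
  interpolate on \<open>A\<close> the signs of the Lagrange basis at \<open>x0\<close>. If \<open>R\<close> exceeded 1 in absolute value
  at a point of \<open>E\<close>, a Remez exchange with that point would decrease \<open>\<Lambda>\<close>; so \<open>R\<close> has norm 1.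
  Evaluation at \<open>x0\<close> is a combination of the evaluations at the nodes with the same signs, so \<open>R\<close>
  is the unique extremal polynomial up to scaling, and it is the dual residual polynomial. Optimality depends
  only on the signs of the weights of the functional: they are constant while \<open>x0\<close> stays in one
  gap, and for \<open>x0\<close> outside the convex hull of \<open>E\<close> they agree, up to a common sign, with those of
  the functional taking the leading coefficient, whose extremal polynomial is the Chebyshev polynomial.
\<close>

section \<open>Lagrange interpolation at real nodes\<close>

definition lagrange_basis :: "real set \<Rightarrow> real \<Rightarrow> real \<Rightarrow> real" where
  "lagrange_basis A a x = (\<Prod>b\<in>A-{a}. (x - b) / (a - b))"

definition lebesgue_function :: "real set \<Rightarrow> real \<Rightarrow> real" where
  "lebesgue_function A x = (\<Sum>a\<in>A. \<bar>lagrange_basis A a x\<bar>)"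

text \<open>These are the barycentric weights, the leading coefficients of the Lagrange
  basis.\<close>

definition lagrange_lead :: "real set \<Rightarrow> real \<Rightarrow> real" where
  "lagrange_lead A a = (\<Prod>b\<in>A-{a}. 1 / (a - b))"

definition lagrange_poly :: "real set \<Rightarrow> real \<Rightarrow> complex poly" where
  "lagrange_poly A a =
     smult (of_real (lagrange_lead A a)) (\<Prod>b\<in>A-{a}. [:- complex_of_real b, 1:])"

lemma poly_lagrange_poly:
  "poly (lagrange_poly A a) (complex_of_real x) = complex_of_real (lagrange_basis A a x)"
proof -
  have "lagrange_basis A a x = lagrange_lead A a * (\<Prod>b\<in>A-{a}. x - b)"
    by (simp add: lagrange_basis_def lagrange_lead_def prod.distrib[symmetric])
  then show ?thesis
    by (simp add: lagrange_poly_def poly_prod)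
qed

lemma degree_lagrange_poly_le:
  assumes "card A = Suc n" "a \<in> A"
  shows "degree (lagrange_poly A a) \<le> n"
proof -
  have "degree (\<Prod>b\<in>A-{a}. [:- complex_of_real b, 1:]) = (\<Sum>b\<in>A-{a}. 1)"
    by (subst degree_prod_sum_eq) auto
  then have "degree (\<Prod>b\<in>A-{a}. [:- complex_of_real b, 1:]) \<le> n"
    using assms by simp
  then show ?thesis
    unfolding lagrange_poly_def by (rule order_trans[OF degree_smult_le])
qed

lemma coeff_lagrange_poly:
  assumes "card A = Suc n" "a \<in> A"
  shows "coeff (lagrange_poly A a) n = complex_of_real (lagrange_lead A a)"
proof -
  have "degree (\<Prod>b\<in>A-{a}. [:- complex_of_real b, 1:]) = n"
    using assms by (subst degree_prod_sum_eq) auto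
  moreover have "lead_coeff (\<Prod>b\<in>A-{a}. [:- complex_of_real b, 1:]) = 1"
    by (simp add: lead_coeff_prod)
  ultimately show ?thesis
    by (simp add: lagrange_poly_def)
qed

lemma lagrange_basis_self: "a \<in> A \<Longrightarrow> lagrange_basis A a a = 1"
  unfolding lagrange_basis_def by (intro prod.neutral) auto

lemma lagrange_basis_node:
  "finite A \<Longrightarrow> b \<in> A \<Longrightarrow> a \<noteq> b \<Longrightarrow> lagrange_basis A a b = 0"
  unfolding lagrange_basis_def by (rule prod_zero) auto

lemma lagrange_basis_nonzero:
  "finite A \<Longrightarrow> x \<notin> A \<Longrightarrow> lagrange_basis A a x \<noteq> 0"
  unfolding lagrange_basis_def by auto

lemma poly_eq_on_nodes:
  fixes P Q :: "complex poly"
  assumes "card A = Suc n" "degree P \<le> n" "degree Q \<le> n"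
    and "\<And>a. a \<in> A \<Longrightarrow> poly P (complex_of_real a) = poly Q (complex_of_real a)"
  shows "P = Q"
proof (rule poly_eqI_degree[where A = "complex_of_real ` A"])
  have "card (complex_of_real ` A) = Suc n"
    using assms(1) by (simp add: card_image inj_on_def)
  then show "card (complex_of_real ` A) > degree P" "card (complex_of_real ` A) > degree Q"
    using assms by auto
qed (use assms in auto)

definition interpolant :: "real set \<Rightarrow> (real \<Rightarrow> complex) \<Rightarrow> complex poly" where
  "interpolant A f = (\<Sum>a\<in>A. smult (f a) (lagrange_poly A a))"

lemma degree_interpolant_le:
  "card A = Suc n \<Longrightarrow> degree (interpolant A f) \<le> n"
  unfolding interpolant_def
  by (intro degree_sum_le) (auto intro!: order_trans[OF degree_smult_le] degree_lagrange_poly_le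
      simp: card_ge_0_finite)

lemma poly_interpolant:
  "poly (interpolant A f) (complex_of_real x) =
     (\<Sum>a\<in>A. f a * complex_of_real (lagrange_basis A a x))"
  by (simp add: interpolant_def poly_sum poly_lagrange_poly)

lemma poly_interpolant_node:
  assumes "finite A" "a \<in> A"
  shows "poly (interpolant A f) (complex_of_real a) = f a"
proof -
  have "poly (interpolant A f) (complex_of_real a) = (\<Sum>b\<in>A. if b = a then f a else 0)"
    unfolding poly_interpolant
    by (rule sum.cong) (use assms in \<open>auto simp: lagrange_basis_self lagrange_basis_node\<close>)
  then show ?thesis
    using assms by simp
qed

lemma interpolant_of_poly:
  assumes "card A = Suc n" "degree P \<le> n"
  shows "interpolant A (\<lambda>a. poly P (complex_of_real a)) = P"
  by (rule poly_eq_on_nodes[OF assms(1)])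
    (use assms in \<open>auto simp: degree_interpolant_le poly_interpolant_node card_ge_0_finite\<close>)

lemma lagrange_interpolation:
  assumes "card A = Suc n" "degree P \<le> n"
  shows "poly P (complex_of_real x) =
    (\<Sum>a\<in>A. complex_of_real (lagrange_basis A a x) * poly P (complex_of_real a))"
  using poly_interpolant[of A "\<lambda>a. poly P (complex_of_real a)" x]
  by (simp add: interpolant_of_poly[OF assms] mult.commute)

text \<open>The coefficient at \<open>n\<close> is linear on polynomials of degree at most
  \<open>n\<close>, unlike \<open>lead_coeff\<close>; so it is a functional of the same kind as
  evaluation at a point, with other weights.\<close>

lemma coeff_lagrange_interpolation:
  assumes "card A = Suc n" "degree P \<le> n"
  shows "coeff P n =
    (\<Sum>a\<in>A. complex_of_real (lagrange_lead A a) * poly P (complex_of_real a))"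
proof -
  have "coeff P n = coeff (interpolant A (\<lambda>a. poly P (complex_of_real a))) n"
    by (simp add: interpolant_of_poly[OF assms])
  also have "\<dots> = (\<Sum>a\<in>A. complex_of_real (lagrange_lead A a) * poly P (complex_of_real a))"
    by (simp add: interpolant_def coeff_sum coeff_lagrange_poly[OF assms(1)] mult.commute)
  finally show ?thesis .
qed

section \<open>Exchanging a node\<close>

text \<open>Each old basis polynomial is expanded in the new basis on \<open>B\<close>. At the
  common nodes its values are 0 or 1, so at most two terms survive.\<close>

lemma lagrange_basis_exchange:
  assumes A: "card A = Suc n" and j: "j \<in> A" and s: "s \<notin> A" and B: "B = insert s (A - {j})"
  shows "lagrange_basis B s x = lagrange_basis A j x / lagrange_basis A j s"
    and "i \<in> A - {j} \<Longrightarrow>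
      lagrange_basis B i x = lagrange_basis A i x - lagrange_basis A i s * lagrange_basis B s x"
proof -
  have fin: "finite A"
    using A by (simp add: card_ge_0_finite)
  have B': "card B = Suc n"
    using A j s fin by (simp add: B)
  have expand: "lagrange_basis A i x = (\<Sum>b\<in>B. lagrange_basis A i b * lagrange_basis B b x)"
    if "i \<in> A" for i
    using lagrange_interpolation[OF B' degree_lagrange_poly_le[OF A that], of x]
    by (simp add: poly_lagrange_poly mult.commute flip: of_real_mult of_real_sum)
  have split: "(\<Sum>b\<in>B. lagrange_basis A i b * lagrange_basis B b x) =
      lagrange_basis A i s * lagrange_basis B s x +
      (\<Sum>b\<in>A-{j}. lagrange_basis A i b * lagrange_basis B b x)" for i
    using fin s by (simp add: B)
  have "(\<Sum>b\<in>A-{j}. lagrange_basis A j b * lagrange_basis B b x) = 0"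
    by (rule sum.neutral) (use fin in \<open>auto simp: lagrange_basis_node\<close>)
  with expand[OF j] split[of j] lagrange_basis_nonzero[OF fin s, of j]
  show "lagrange_basis B s x = lagrange_basis A j x / lagrange_basis A j s"
    by (simp add: field_simps)
  assume i: "i \<in> A - {j}"
  have "(\<Sum>b\<in>A-{j}. lagrange_basis A i b * lagrange_basis B b x) =
      (\<Sum>b\<in>A-{j}. if b = i then lagrange_basis B i x else 0)"
    by (rule sum.cong) (use fin i in \<open>auto simp: lagrange_basis_node lagrange_basis_self\<close>)
  also have "\<dots> = lagrange_basis B i x"
    using i fin by simp
  finally show "lagrange_basis B i x =
      lagrange_basis A i x - lagrange_basis A i s * lagrange_basis B s x"
    using expand[of i] split[of i] i by simp
qed

text \<open>
  This is a simplex step: \<open>j\<close> is chosen by the ratio test, so that all remaining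
  coefficients keep their signs when evaluation at \<open>s\<close> enters the representation.
\<close>

lemma lebesgue_function_exchange:
  assumes A: "card A = Suc n" and x: "x \<notin> A"
    and big: "\<bar>\<Sum>a\<in>A. sgn (lagrange_basis A a x) * lagrange_basis A a s\<bar> > 1"
  shows "\<exists>j\<in>A. s \<notin> A \<and> lebesgue_function (insert s (A - {j})) x < lebesgue_function A x"
proof -
  define L where "L = lagrange_basis A"
  define \<sigma> where "\<sigma> a = sgn (L a x)" for a
  \<comment> \<open>The value at \<open>s\<close> of the polynomial that interpolates the signs
    \<open>\<sigma>\<close> on \<open>A\<close>.\<close>
  define r where "r = (\<Sum>a\<in>A. \<sigma> a * L a s)"
  define \<tau> where "\<tau> = sgn r"
  have fin: "finite A"
    using A by (simp add: card_ge_0_finite)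
  have L0: "L a x \<noteq> 0" for a
    using lagrange_basis_nonzero[OF fin x] by (simp add: L_def)
  have \<sigma>L: "\<sigma> a * L a x = \<bar>L a x\<bar>" and \<sigma>1: "\<bar>\<sigma> a\<bar> = 1" for a
    using L0[of a] by (auto simp: \<sigma>_def sgn_if)
  have r1: "\<bar>r\<bar> > 1"
    using big by (simp add: r_def L_def \<sigma>_def)
  have \<tau>r: "\<tau> * r = \<bar>r\<bar>" and \<tau>1: "\<bar>\<tau>\<bar> = 1"
    using r1 by (auto simp: \<tau>_def sgn_if)
  \<comment> \<open>At a node the sum collapses to one sign, which is not larger than 1 in absolute
    value.\<close>
  have s: "s \<notin> A"
  proof
    assume sA: "s \<in> A"
    have "r = (\<Sum>a\<in>A. if a = s then \<sigma> s else 0)"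
      unfolding r_def
      by (rule sum.cong)
        (use sA fin in \<open>auto simp: L_def lagrange_basis_self lagrange_basis_node\<close>)
    then show False
      using r1 \<sigma>1[of s] sA fin by simp
  qed
  \<comment> \<open>When \<open>s\<close> enters with a weight of sign \<open>\<tau>\<close>, the
    weights that move towards 0 are those of the nodes in \<open>Ap\<close>; the leaving node must
    be one of them.\<close>
  define Ap where "Ap = {a\<in>A. \<tau> * \<sigma> a * L a s > 0}"
  have "Ap \<noteq> {}"
  proof
    assume "Ap = {}"
    then have "(\<Sum>a\<in>A. \<tau> * \<sigma> a * L a s) \<le> 0"
      by (intro sum_nonpos) (auto simp: Ap_def not_less)
    moreover have "(\<Sum>a\<in>A. \<tau> * \<sigma> a * L a s) = \<bar>r\<bar>"
      unfolding \<tau>r[symmetric] by (simp add: r_def sum_distrib_left mult.assoc)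
    ultimately show False
      using r1 by simp
  qed
  moreover have "finite Ap"
    using fin by (simp add: Ap_def)
  ultimately obtain j where j: "j \<in> Ap"
    and jmin: "\<And>a. a \<in> Ap \<Longrightarrow> \<bar>L j x\<bar> / \<bar>L j s\<bar> \<le> \<bar>L a x\<bar> / \<bar>L a s\<bar>"
    using arg_min_if_finite(1)[of Ap "\<lambda>a. \<bar>L a x\<bar> / \<bar>L a s\<bar>"]
      arg_min_least[of Ap _ "\<lambda>a. \<bar>L a x\<bar> / \<bar>L a s\<bar>"] by blast
  have jA: "j \<in> A" and jpos: "\<tau> * \<sigma> j * L j s > 0"
    using j by (auto simp: Ap_def)
  have Lpos: "\<bar>L a s\<bar> = \<tau> * \<sigma> a * L a s" if "a \<in> Ap" for a
  proof -
    have "\<bar>\<tau> * \<sigma> a * L a s\<bar> = \<bar>L a s\<bar>"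
      by (simp add: abs_mult \<sigma>1 \<tau>1)
    then show ?thesis
      using that by (simp add: Ap_def)
  qed
  define B where "B = insert s (A - {j})"
  \<comment> \<open>The weight that \<open>s\<close> receives in the new representation;
    \<open>\<bar>c\<bar>\<close> is the minimal ratio and \<open>\<tau>\<close> its sign.\<close>
  define c where "c = L j x / L j s"
  note ex = lagrange_basis_exchange[where x = x, OF A jA s B_def, folded L_def, folded c_def]
  have c: "c = \<tau> * \<bar>c\<bar>"
  proof -
    have "\<tau> * \<bar>c\<bar> = \<tau> * (\<sigma> j * L j x) / (\<tau> * \<sigma> j * L j s)"
      by (simp add: c_def \<sigma>L Lpos[OF j])
    also have "\<dots> = c"
      using \<tau>1 \<sigma>1[of j] by (auto simp: c_def)
    finally show ?thesis ..
  qed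
  have cpos: "\<bar>c\<bar> > 0"
  proof -
    have "L j s \<noteq> 0"
      using jpos by auto
    then show ?thesis
      using L0[of j] by (simp add: c_def)
  qed
  \<comment> \<open>No weight crosses 0: on \<open>Ap\<close> by minimality of the ratio, elsewhere
    because the weight does not move towards 0.\<close>
  have keep: "\<bar>L i x - c * L i s\<bar> = \<sigma> i * L i x - c * (\<sigma> i * L i s)" if "i \<in> A" for i
  proof -
    have "\<bar>c\<bar> * (\<tau> * \<sigma> i * L i s) \<le> \<bar>L i x\<bar>"
    proof (cases "i \<in> Ap")
      case True
      then have "\<bar>c\<bar> \<le> \<bar>L i x\<bar> / \<bar>L i s\<bar>" and "\<bar>L i s\<bar> > 0"
        using jmin[OF True] Lpos[OF True] by (auto simp: c_def Ap_def)
      then show ?thesis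
        by (simp add: Lpos[OF True, symmetric] pos_le_divide_eq)
    next
      case False
      then have "\<tau> * \<sigma> i * L i s \<le> 0"
        using that by (auto simp: Ap_def)
      then have "\<bar>c\<bar> * (\<tau> * \<sigma> i * L i s) \<le> 0"
        by (simp add: mult_nonneg_nonpos)
      then show ?thesis
        by linarith
    qed
    also have "\<bar>c\<bar> * (\<tau> * \<sigma> i * L i s) = c * (\<sigma> i * L i s)"
      using arg_cong[OF c, of "\<lambda>u. u * (\<sigma> i * L i s)"] by (simp only: mult_ac)
    finally have "0 \<le> \<sigma> i * (L i x - c * L i s)"
      unfolding right_diff_distrib \<sigma>L by (simp only: mult_ac diff_ge_0_iff_ge)
    then have "\<sigma> i * (L i x - c * L i s) = \<bar>\<sigma> i * (L i x - c * L i s)\<bar>"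
      by simp
    also have "\<dots> = \<bar>L i x - c * L i s\<bar>"
      by (simp add: abs_mult \<sigma>1)
    finally show ?thesis
      by (simp add: algebra_simps)
  qed
  have "lebesgue_function B x = \<bar>c\<bar> + (\<Sum>i\<in>A-{j}. \<bar>lagrange_basis B i x\<bar>)"
    using fin s by (simp add: lebesgue_function_def B_def ex(1)[unfolded B_def])
  also have "(\<Sum>i\<in>A-{j}. \<bar>lagrange_basis B i x\<bar>) = (\<Sum>i\<in>A-{j}. \<bar>L i x - c * L i s\<bar>)"
    by (rule sum.cong) (auto simp: ex mult.commute)
  \<comment> \<open>By the choice of \<open>c\<close> the term of the leaving node is 0, so it can
    be added back.\<close>
  also have "\<dots> = (\<Sum>i\<in>A. \<bar>L i x - c * L i s\<bar>)"
    using jpos by (subst sum.remove[OF fin jA]) (auto simp: c_def)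
  also have "\<dots> = (\<Sum>i\<in>A. \<bar>L i x\<bar>) - c * r"
    by (simp add: keep \<sigma>L sum_subtractf r_def sum_distrib_left)
  also have "(\<Sum>i\<in>A. \<bar>L i x\<bar>) = lebesgue_function A x"
    by (simp add: lebesgue_function_def L_def)
  also have "c * r = \<bar>c\<bar> * (\<tau> * r)"
    using arg_cong[OF c, of "\<lambda>u. u * r"] by (simp only: mult_ac)
  also note \<tau>r
  finally have "lebesgue_function B x = lebesgue_function A x - \<bar>c\<bar> * (\<bar>r\<bar> - 1)"
    by (simp add: algebra_simps)
  moreover have "\<bar>c\<bar> * (\<bar>r\<bar> - 1) > 0"
    using cpos r1 by simp
  ultimately have "lebesgue_function B x < lebesgue_function A x"
    by linarith
  then show ?thesis
    using jA s B_def by auto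
qed

section \<open>Existence of a node set with minimal Lebesgue function\<close>

text \<open>Passing from node sets to tuples makes continuity and compactness available.\<close>

lemma lebesgue_function_image:
  assumes "inj_on t {..n::nat}"
  shows "lebesgue_function (t ` {..n}) x =
    (\<Sum>j\<le>n. \<bar>\<Prod>i\<in>{..n}-{j}. (x - t i) / (t j - t i)\<bar>)"
proof -
  have "lagrange_basis (t ` {..n}) (t j) x = (\<Prod>i\<in>{..n}-{j}. (x - t i) / (t j - t i))"
    if "j \<le> n" for j
  proof -
    have "t ` {..n} - {t j} = t ` ({..n} - {j})"
      using assms that by (auto simp: inj_on_def)
    moreover have "inj_on t ({..n} - {j})"
      using assms by (rule inj_on_subset) auto
    ultimately show ?thesis
      by (simp add: lagrange_basis_def prod.reindex)
  qed
  then show ?thesis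
    by (simp add: lebesgue_function_def sum.reindex[OF assms])
qed

text \<open>Tychonoff's theorem. Whole sequences stand in for tuples, so that the product topology
  on the function type applies.\<close>

lemma compact_functions_into:
  fixes E :: "real set"
  assumes "compact E"
  shows "compact {t :: nat \<Rightarrow> real. \<forall>i. t i \<in> E}"
proof -
  have "compactin (product_topology (\<lambda>i::nat. euclidean :: real topology) UNIV)
      (PiE UNIV (\<lambda>_. E))"
    using assms by (simp add: compactin_PiE)
  moreover have "PiE UNIV (\<lambda>_. E) = {t :: nat \<Rightarrow> real. \<forall>i. t i \<in> E}"
    by (auto simp: PiE_def)
  ultimately show ?thesis
    by (simp add: euclidean_product_topology)
qed

text \<open>
  Coalescing nodes are kept away from the minimizing configurations because the numerators in
  \<^const>\<open>lagrange_basis\<close> are bounded below by a power of the distance from \<open>x\<close> to \<open>E\<close>.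
\<close>

lemma lebesgue_function_attains_min:
  assumes E: "compact E" "infinite E" and x: "x \<notin> E"
  shows "\<exists>A\<subseteq>E. card A = Suc n \<and>
    (\<forall>B\<subseteq>E. card B = Suc n \<longrightarrow> lebesgue_function A x \<le> lebesgue_function B x)"
proof -
  obtain d where d: "d > 0" "\<And>e. e \<in> E \<Longrightarrow> d \<le> \<bar>x - e\<bar>"
    using separate_point_closed[OF compact_imp_closed[OF E(1)] x] by (auto simp: dist_real_def)
  obtain A0 where A0: "A0 \<subseteq> E" "card A0 = Suc n"
    using infinite_arbitrarily_large[OF E(2)] by blast
  define M where "M = lebesgue_function A0 x"
  define gap where "gap t j = (\<Prod>i\<in>{..n}-{j}. \<bar>t j - t i\<bar>)" for t :: "nat \<Rightarrow> real" and j
  define F where "F t = (\<Sum>j\<le>n. \<bar>\<Prod>i\<in>{..n}-{j}. (x - t i) / (t j - t i)\<bar>)" for t :: "nat \<Rightarrow> real"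
  \<comment> \<open>For distinct nodes in \<open>E\<close> this condition follows from
    \<open>F t \<le> M\<close>. Being free of division it is closed, and since
    \<open>d ^ n > 0\<close> it excludes coinciding nodes.\<close>
  define K where "K = {t. \<forall>i. t i \<in> E} \<inter> (\<Inter>j\<in>{..n}. {t. d ^ n \<le> M * gap t j})"
  have cont_coord: "continuous_on S (\<lambda>t :: nat \<Rightarrow> real. t i)" for S i
    by (rule continuous_on_subset[OF continuous_on_product_coordinates]) simp
  have injK: "inj_on t {..n}" if "t \<in> K" for t
  proof (rule inj_onI, rule ccontr)
    fix i j assume ij: "i \<in> {..n}" "j \<in> {..n}" "t i = t j" "i \<noteq> j"
    then have "gap t j = 0"
      unfolding gap_def by (intro prod_zero bexI[of _ i]) auto
    moreover have "d ^ n \<le> M * gap t j"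
      using that ij by (auto simp: K_def)
    ultimately show False
      using d(1) zero_less_power[OF d(1), of n] by simp
  qed
  have "compact K"
    unfolding K_def
    by (intro compact_Int_closed compact_functions_into E closed_INT ballI closed_Collect_le
        continuous_intros cont_coord) (auto simp: gap_def intro!: continuous_intros cont_coord)
  moreover have "continuous_on K F"
    unfolding F_def
    by (intro continuous_intros cont_coord ballI) (use injK in \<open>auto simp: inj_on_def\<close>)
  moreover have inK: "\<exists>t\<in>K. t ` {..n} = B"
    if B: "B \<subseteq> E" "card B = Suc n" and le: "lebesgue_function B x \<le> M" for B
  proof -
    have finB: "finite B"
      using B by (simp add: card_ge_0_finite)
    obtain t0 where "bij_betw t0 {0..<card B} B"
      using ex_bij_betw_nat_finite[OF finB] by blast
    moreover have "{0..<card B} = {..n}"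
      using B by auto
    ultimately have t0: "inj_on t0 {..n}" "t0 ` {..n} = B"
      by (auto simp: bij_betw_def)
    \<comment> \<open>Repeating the last node beyond \<open>n\<close> keeps every coordinate in
      \<open>E\<close>, as \<open>K\<close> demands.\<close>
    define t where "t i = t0 (min i n)" for i
    have tt0: "t i = t0 i" if "i \<le> n" for i
      using that by (simp add: t_def)
    have tinj: "inj_on t {..n}" and tB: "t ` {..n} = B"
      using t0 tt0 by (auto simp: inj_on_def image_iff)
    have tE: "t i \<in> E" for i
      using t0(2) B(1) by (auto simp: t_def)
    have "d ^ n \<le> M * gap t j" if j: "j \<le> n" for j
    proof -
      have "d ^ n = (\<Prod>i\<in>{..n}-{j}. d)"
        using j by simp
      also have "\<dots> \<le> (\<Prod>i\<in>{..n}-{j}. \<bar>x - t i\<bar>)"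
        by (rule prod_mono) (use d tE in auto)
      also have "\<dots> = \<bar>\<Prod>i\<in>{..n}-{j}. (x - t i) / (t j - t i)\<bar> * gap t j"
        unfolding gap_def abs_prod prod.distrib[symmetric]
        by (rule prod.cong) (use tinj j in \<open>auto simp: inj_on_def abs_divide\<close>)
      also have "\<dots> \<le> F t * gap t j"
        unfolding F_def
        by (intro mult_right_mono member_le_sum)
          (use j in \<open>auto simp: gap_def intro!: prod_nonneg\<close>)
      also have "\<dots> \<le> M * gap t j"
        using le lebesgue_function_image[OF tinj, of x]
        by (intro mult_right_mono) (auto simp: tB F_def gap_def intro!: prod_nonneg)
      finally show ?thesis .
    qed
    then have "t \<in> K"
      using tE by (auto simp: K_def)
    then show ?thesis
      using tB by blast
  qed
  moreover have "K \<noteq> {}"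
    using inK[OF A0] by (auto simp: M_def)
  ultimately obtain t where t: "t \<in> K" "\<And>u. u \<in> K \<Longrightarrow> F t \<le> F u"
    using continuous_attains_inf[of K F] by blast
  have F_eq: "F u = lebesgue_function (u ` {..n}) x" if "u \<in> K" for u
    using lebesgue_function_image[OF injK[OF that]] by (simp add: F_def)
  have min_le: "lebesgue_function (t ` {..n}) x \<le> lebesgue_function B x"
    if "B \<subseteq> E" "card B = Suc n" "lebesgue_function B x \<le> M" for B
    using inK[OF that] t F_eq by metis
  \<comment> \<open>A set whose value exceeds \<open>M\<close> is compared through
    \<open>A0\<close>, whose value is \<open>M\<close>.\<close>
  have "lebesgue_function (t ` {..n}) x \<le> lebesgue_function B x"
    if B: "B \<subseteq> E" "card B = Suc n" for B
    using min_le[OF B] min_le[OF A0] by (fastforce simp: M_def)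
  moreover have "t ` {..n} \<subseteq> E"
    using t(1) by (auto simp: K_def)
  moreover have "card (t ` {..n}) = Suc n"
    using card_image[OF injK[OF t(1)]] by simp
  ultimately show ?thesis
    by blast
qed

section \<open>Supremum norm and uniqueness of minimizers\<close>

lemma poly_norm_le_supnorm:
  assumes "compact E" "x \<in> E"
  shows "norm (poly P (complex_of_real x)) \<le> poly_supnorm E P"
proof -
  have "continuous_on E (\<lambda>x. norm (poly P (complex_of_real x)))"
    by (intro continuous_intros)
  then have "bdd_above ((\<lambda>x. norm (poly P (complex_of_real x))) ` E)"
    using assms(1) by (intro bounded_imp_bdd_above compact_imp_bounded compact_continuous_image)
  then show ?thesis
    unfolding poly_supnorm_def using assms(2) by (rule cSUP_upper2) simp
qed

lemma poly_supnorm_smult: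
  assumes "compact E" "E \<noteq> {}"
  shows "poly_supnorm E (smult c P) = norm c * poly_supnorm E P"
proof (rule antisym)
  show "poly_supnorm E (smult c P) \<le> norm c * poly_supnorm E P"
    unfolding poly_supnorm_def[of E "smult c P"]
    by (rule cSUP_least[OF assms(2)])
      (auto simp: norm_mult intro!: mult_left_mono poly_norm_le_supnorm assms)
  show "norm c * poly_supnorm E P \<le> poly_supnorm E (smult c P)"
  proof (cases "c = 0")
    case True
    then show ?thesis
      using assms(2) by (simp add: poly_supnorm_def)
  next
    case False
    have "poly_supnorm E P \<le> poly_supnorm E (smult c P) / norm c"
      unfolding poly_supnorm_def[of E P]
    proof (rule cSUP_least[OF assms(2)])
      fix x assume "x \<in> E"
      then show "norm (poly P (complex_of_real x)) \<le> poly_supnorm E (smult c P) / norm c"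
        using poly_norm_le_supnorm[OF assms(1), of x "smult c P"] False
        by (simp add: norm_mult field_simps)
    qed
    then show ?thesis
      using False by (simp add: field_simps)
  qed
qed

text \<open>The equality case of the triangle inequality: the real parts must all be extremal, and
  the bound on the modulus then leaves no room for an imaginary part.\<close>

lemma convex_combination_extreme:
  fixes f :: "'a \<Rightarrow> complex" and w :: "'a \<Rightarrow> real"
  assumes fin: "finite A" and w: "\<And>a. a \<in> A \<Longrightarrow> w a \<noteq> 0"
    and sum1: "(\<Sum>a\<in>A. of_real (w a) * f a) = 1"
    and bound: "\<And>a. a \<in> A \<Longrightarrow> norm (f a) \<le> 1 / (\<Sum>a\<in>A. \<bar>w a\<bar>)"
    and a: "a \<in> A"
  shows "f a = of_real (sgn (w a) / (\<Sum>a\<in>A. \<bar>w a\<bar>))"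
proof -
  define \<Lambda> where "\<Lambda> = (\<Sum>a\<in>A. \<bar>w a\<bar>)"
  have "\<Lambda> > 0"
    unfolding \<Lambda>_def using w a by (intro sum_pos fin) auto
  have le: "sgn (w b) * Re (f b) \<le> 1 / \<Lambda>" if "b \<in> A" for b
    using abs_Re_le_cmod[of "f b"] bound[OF that] w[OF that]
    by (auto simp: sgn_if \<Lambda>_def)
  have term_nonneg: "0 \<le> \<bar>w b\<bar> * (1 / \<Lambda> - sgn (w b) * Re (f b))" if "b \<in> A" for b
    using le[OF that] by simp
  have "(\<Sum>b\<in>A. w b * Re (f b)) = Re (\<Sum>b\<in>A. of_real (w b) * f b)"
    by simp
  then have re: "(\<Sum>b\<in>A. w b * Re (f b)) = 1"
    by (simp only: sum1) simp
  \<comment> \<open>The slacks in the bounds on the real parts are nonnegative and add up to 0, so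
    each vanishes.\<close>
  have "(\<Sum>b\<in>A. \<bar>w b\<bar> * (1 / \<Lambda> - sgn (w b) * Re (f b))) =
      (\<Sum>b\<in>A. \<bar>w b\<bar> / \<Lambda> - w b * Re (f b))"
    by (rule sum.cong) (auto simp: right_diff_distrib mult_sgn_abs mult.assoc[symmetric] abs_mult_sgn)
  also have "\<dots> = 0"
    using \<open>\<Lambda> > 0\<close> re by (simp add: sum_subtractf flip: sum_divide_distrib) (simp add: \<Lambda>_def)
  finally have "\<bar>w a\<bar> * (1 / \<Lambda> - sgn (w a) * Re (f a)) = 0"
    using sum_nonneg_eq_0_iff[OF fin, of "\<lambda>b. \<bar>w b\<bar> * (1 / \<Lambda> - sgn (w b) * Re (f b))"]
      term_nonneg a by blast
  then have "sgn (w a) * Re (f a) = 1 / \<Lambda>"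
    using w[OF a] by simp
  then have re_a: "Re (f a) = sgn (w a) / \<Lambda>"
    using w[OF a] by (auto simp: sgn_if split: if_splits)
  have "(norm (f a))\<^sup>2 \<le> (1 / \<Lambda>)\<^sup>2"
    using bound[OF a] by (intro power_mono) (auto simp: \<Lambda>_def)
  moreover have "(Re (f a))\<^sup>2 = (1 / \<Lambda>)\<^sup>2"
    using w[OF a] by (auto simp: re_a sgn_if power2_eq_square)
  ultimately have "(Im (f a))\<^sup>2 \<le> 0"
    by (simp add: cmod_power2)
  then have "Im (f a) = 0"
    by simp
  then show ?thesis
    using re_a by (simp add: complex_eq_iff \<Lambda>_def)
qed

text \<open>
  The sign \<open>s\<close> is needed only when \<open>\<phi>\<close> is the leading coefficient: for a point to the left
  of \<open>E\<close>, its weights differ from those of evaluation by the sign \<open>(-1)^n\<close>.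
\<close>

lemma unique_minimizer:
  fixes w :: "real \<Rightarrow> real" and \<phi> :: "complex poly \<Rightarrow> complex"
  assumes E: "compact E" and A: "A \<subseteq> E" "card A = Suc n"
    and w: "\<And>a. a \<in> A \<Longrightarrow> w a \<noteq> 0"
    and \<phi>: "\<And>P. degree P \<le> n \<Longrightarrow> \<phi> P = (\<Sum>a\<in>A. of_real (w a) * poly P (of_real a))"
    and R: "degree R \<le> n" "poly_supnorm E R = 1"
    and s: "s = 1 \<or> s = -1"
    and sgn: "\<And>a. a \<in> A \<Longrightarrow> poly R (of_real a) = of_real (s * sgn (w a))"
  shows "(THE P. is_arg_min (poly_supnorm E) (\<lambda>P. degree P \<le> n \<and> \<phi> P = 1) P) =
      smult (of_real (s / (\<Sum>a\<in>A. \<bar>w a\<bar>))) R"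
    and "\<phi> R = of_real (s * (\<Sum>a\<in>A. \<bar>w a\<bar>))"
proof -
  define \<Lambda> where "\<Lambda> = (\<Sum>a\<in>A. \<bar>w a\<bar>)"
  define Q where "Q = smult (complex_of_real (s / \<Lambda>)) R"
  have fin: "finite A" and "A \<noteq> {}"
    using A by (auto simp: card_ge_0_finite)
  then have "E \<noteq> {}"
    using A by auto
  have "\<Lambda> > 0"
    unfolding \<Lambda>_def using w \<open>A \<noteq> {}\<close> by (intro sum_pos fin) auto
  have "\<phi> R = (\<Sum>a\<in>A. of_real (s * \<bar>w a\<bar>))"
    unfolding \<phi>[OF R(1)]
    by (rule sum.cong) (auto simp: sgn mult_sgn_abs abs_sgn simp flip: of_real_mult)
  then show \<phi>R: "\<phi> R = of_real (s * (\<Sum>a\<in>A. \<bar>w a\<bar>))"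
    by (simp add: sum_distrib_left)
  have dQ: "degree Q \<le> n"
    unfolding Q_def by (rule order_trans[OF degree_smult_le R(1)])
  have "\<phi> Q = complex_of_real (s / \<Lambda>) * \<phi> R"
    by (simp add: \<phi>[OF dQ] \<phi>[OF R(1)]) (simp add: Q_def sum_distrib_left sum_divide_distrib mult_ac)
  also have "\<dots> = of_real (s / \<Lambda> * (s * \<Lambda>))"
    by (simp only: \<phi>R \<Lambda>_def of_real_mult)
  also have "s / \<Lambda> * (s * \<Lambda>) = 1"
    using s \<open>\<Lambda> > 0\<close> by auto
  finally have \<phi>Q: "\<phi> Q = 1"
    by simp
  have normQ: "poly_supnorm E Q = 1 / \<Lambda>"
    unfolding Q_def poly_supnorm_smult[OF E \<open>E \<noteq> {}\<close>] R(2) using s \<open>\<Lambda> > 0\<close> by (auto simp: norm_divide)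
  \<comment> \<open>Allowing every norm up to \<open>1 / \<Lambda>\<close> yields both minimality of
    \<open>Q\<close> and uniqueness: a strictly better competitor would equal
    \<open>Q\<close>.\<close>
  have uniq: "P = Q" if "degree P \<le> n" "\<phi> P = 1" "poly_supnorm E P \<le> 1 / \<Lambda>" for P
  proof (rule poly_eq_on_nodes[OF A(2) that(1) dQ])
    fix a assume a: "a \<in> A"
    have "poly P (of_real a) = of_real (sgn (w a) / \<Lambda>)"
      unfolding \<Lambda>_def
    proof (rule convex_combination_extreme[OF fin w _ _ a])
      show "(\<Sum>a\<in>A. of_real (w a) * poly P (of_real a)) = 1"
        using \<phi>[OF that(1)] that(2) by simp
      show "norm (poly P (of_real b)) \<le> 1 / (\<Sum>a\<in>A. \<bar>w a\<bar>)" if "b \<in> A" for b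
        using poly_norm_le_supnorm[OF E, of b P] \<open>poly_supnorm E P \<le> 1 / \<Lambda>\<close> that A(1)
        by (auto simp: \<Lambda>_def)
    qed
    also have "\<dots> = poly Q (of_real a)"
      using s by (auto simp: Q_def sgn[OF a])
    finally show "poly P (of_real a) = poly Q (of_real a)" .
  qed
  show "(THE P. is_arg_min (poly_supnorm E) (\<lambda>P. degree P \<le> n \<and> \<phi> P = 1) P) =
      smult (of_real (s / (\<Sum>a\<in>A. \<bar>w a\<bar>))) R"
    unfolding \<Lambda>_def[symmetric] Q_def[symmetric]
  proof (rule the_equality)
    show "is_arg_min (poly_supnorm E) (\<lambda>P. degree P \<le> n \<and> \<phi> P = 1) Q"
      unfolding is_arg_min_def using dQ \<phi>Q normQ uniq
      by (metis less_eq_real_def order_less_irrefl)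
    show "P = Q" if "is_arg_min (poly_supnorm E) (\<lambda>P. degree P \<le> n \<and> \<phi> P = 1) P" for P
      using that dQ \<phi>Q normQ uniq[of P] unfolding is_arg_min_def
      by (metis linorder_not_less)
  qed
qed

section \<open>Extremal signatures and residual polynomials\<close>

text \<open>The point \<open>x\<close> enters the conclusion about \<open>R\<close> only through
  signs, so the same \<open>A\<close> and \<open>R\<close> can serve other points.\<close>

lemma exists_extremal_signature:
  assumes E: "compact E" "infinite E" and x: "x \<notin> E"
  obtains A R where "A \<subseteq> E" "card A = Suc n" "degree R \<le> n" "poly_supnorm E R = 1"
    "\<And>a. a \<in> A \<Longrightarrow> poly R (complex_of_real a) = complex_of_real (sgn (lagrange_basis A a x))"
proof -
  obtain A where A: "A \<subseteq> E" "card A = Suc n"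
    and Amin: "\<And>B. B \<subseteq> E \<Longrightarrow> card B = Suc n \<Longrightarrow> lebesgue_function A x \<le> lebesgue_function B x"
    using lebesgue_function_attains_min[OF E x] by blast
  have fin: "finite A" and "A \<noteq> {}" and xA: "x \<notin> A"
    using A x by (auto simp: card_ge_0_finite)
  define R where "R = interpolant A (\<lambda>a. complex_of_real (sgn (lagrange_basis A a x)))"
  have node: "poly R (complex_of_real a) = complex_of_real (sgn (lagrange_basis A a x))"
    if "a \<in> A" for a
    using poly_interpolant_node[OF fin that] by (simp add: R_def)
  have bound: "norm (poly R (complex_of_real s)) \<le> 1" if "s \<in> E" for s
  proof (rule ccontr)
    assume "\<not> norm (poly R (complex_of_real s)) \<le> 1"
    then have "\<bar>\<Sum>a\<in>A. sgn (lagrange_basis A a x) * lagrange_basis A a s\<bar> > 1"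
      by (simp add: R_def poly_interpolant
          flip: of_real_mult of_real_sum)
    from lebesgue_function_exchange[OF A(2) xA this]
    obtain j where j: "j \<in> A" "s \<notin> A"
      "lebesgue_function (insert s (A - {j})) x < lebesgue_function A x"
      by blast
    have "lebesgue_function A x \<le> lebesgue_function (insert s (A - {j})) x"
      by (rule Amin) (use A j fin that in auto)
    with j(3) show False
      by simp
  qed
  obtain a where a: "a \<in> A"
    using \<open>A \<noteq> {}\<close> by blast
  have "norm (poly R (complex_of_real a)) = 1"
    using lagrange_basis_nonzero[OF fin xA, of a] by (simp add: node[OF a] abs_sgn_eq)
  then have "1 \<le> poly_supnorm E R"
    using poly_norm_le_supnorm[OF E(1), of a R] a A(1) by auto
  moreover have "poly_supnorm E R \<le> 1"
    unfolding poly_supnorm_def using a A(1) by (intro cSUP_least bound) auto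
  ultimately have "poly_supnorm E R = 1"
    by simp
  moreover have "degree R \<le> n"
    unfolding R_def by (rule degree_interpolant_le[OF A(2)])
  ultimately show ?thesis
    using that[OF A _ _ node] by blast
qed

text \<open>\<open>unique_minimizer\<close> for evaluation at \<open>x\<close>: the absolute weights
  add up to the Lebesgue function, whose reciprocal is the minimal norm. Normalizing by that norm
  gives back \<open>R\<close>.\<close>

lemma residual_poly_eq:
  assumes E: "compact E" and A: "A \<subseteq> E" "card A = Suc n" and x: "x \<notin> E"
    and R: "degree R \<le> n" "poly_supnorm E R = 1"
    and sgn: "\<And>a. a \<in> A \<Longrightarrow> poly R (complex_of_real a) = complex_of_real (sgn (lagrange_basis A a x))"
  shows "lebesgue_function A x > 0"
    and "residual_poly E x n = smult (complex_of_real (1 / lebesgue_function A x)) R"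
    and "poly R (complex_of_real x) = complex_of_real (lebesgue_function A x)"
    and "dual_residual_poly E x n = R"
proof -
  have fin: "finite A" and "A \<noteq> {}" and xA: "x \<notin> A"
    using A x by (auto simp: card_ge_0_finite)
  have "E \<noteq> {}"
    using \<open>A \<noteq> {}\<close> A by auto
  note L0 = lagrange_basis_nonzero[OF fin xA]
  show pos: "lebesgue_function A x > 0"
    unfolding lebesgue_function_def using L0 \<open>A \<noteq> {}\<close> by (intro sum_pos fin) auto
  have *: "poly R (complex_of_real a) = of_real (1 * sgn (lagrange_basis A a x))" if "a \<in> A" for a
    using sgn[OF that] by simp
  note um = unique_minimizer[where \<phi> = "\<lambda>P. poly P (complex_of_real x)" and s = 1,
      OF E A L0 lagrange_interpolation[OF A(2)] R _ *]
  show res: "residual_poly E x n = smult (complex_of_real (1 / lebesgue_function A x)) R"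
    using um(1) by (simp add: residual_poly_def lebesgue_function_def)
  show "poly R (complex_of_real x) = complex_of_real (lebesgue_function A x)"
    using um(2) by (simp add: lebesgue_function_def)
  have "poly_supnorm E (residual_poly E x n) = 1 / lebesgue_function A x"
    using pos by (simp add: res poly_supnorm_smult[OF E \<open>E \<noteq> {}\<close>] R norm_divide)
  then show "dual_residual_poly E x n = R"
    using pos unfolding dual_residual_poly_def by (simp add: res)
qed

section \<open>Signs of the weights and the Chebyshev polynomial\<close>

lemma sgn_prod: "sgn (prod f A) = (\<Prod>a\<in>A. sgn (f a :: real))"
  by (induction A rule: infinite_finite_induct) (auto simp: sgn_mult)

text \<open>If the signs differed, \<open>b\<close> would lie between \<open>x\<close> and
  \<open>y\<close>, hence in a connected set that avoids \<open>E\<close>.\<close>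

lemma sgn_diff_connected_component:
  fixes E :: "real set"
  assumes "connected_component (- E) x y" "b \<in> E"
  shows "sgn (x - b) = sgn (y - b)"
proof -
  obtain T where T: "connected T" "T \<subseteq> - E" "x \<in> T" "y \<in> T"
    using assms(1) by (auto simp: connected_component_def)
  have "b \<notin> T"
    using T assms(2) by auto
  then have "\<not> (x \<le> b \<and> b \<le> y)" "\<not> (y \<le> b \<and> b \<le> x)"
    using connectedD_interval[OF T(1,3,4)] connectedD_interval[OF T(1,4,3)] by blast+
  then show ?thesis
    by (auto simp: sgn_if)
qed

text \<open>Separates the dependence on \<open>x\<close> from the sign of the leading-coefficient
  weight; this serves both the gaps and the outer intervals.\<close>

lemma sgn_lagrange_basis:
  "sgn (lagrange_basis A a x) = (\<Prod>b\<in>A-{a}. sgn (x - b)) * sgn (lagrange_lead A a)"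
  by (simp add: lagrange_basis_def lagrange_lead_def sgn_prod prod.distrib[symmetric]
      divide_inverse sgn_mult)

lemma chebyshev_poly_eq:
  assumes E: "compact E" and A: "A \<subseteq> E" "card A = Suc n"
    and R: "degree R \<le> n" "poly_supnorm E R = 1" and s: "s = 1 \<or> s = -1"
    and sgn: "\<And>a. a \<in> A \<Longrightarrow> poly R (complex_of_real a) = complex_of_real (s * sgn (lagrange_lead A a))"
  shows "chebyshev_poly E n = smult (complex_of_real (s / (\<Sum>a\<in>A. \<bar>lagrange_lead A a\<bar>))) R"
proof -
  have "finite A"
    using A by (auto simp: card_ge_0_finite)
  then have L0: "lagrange_lead A a \<noteq> 0" for a
    by (auto simp: lagrange_lead_def)
  \<comment> \<open>A nonzero coefficient at \<open>n\<close> forces degree \<open>n\<close>, so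
    being monic becomes the normalization \<open>\<phi> P = 1\<close> of
    \<open>unique_minimizer\<close>.\<close>
  have "(degree P = n \<and> lead_coeff P = 1) \<longleftrightarrow> (degree P \<le> n \<and> coeff P n = 1)" for P :: "complex poly"
    by (metis le_antisym le_degree order_refl zero_neq_one)
  then show ?thesis
    unfolding chebyshev_poly_def
    using unique_minimizer(1)[where \<phi> = "\<lambda>P. coeff P n", OF E A L0 coeff_lagrange_interpolation[OF A(2)] R s sgn]
    by simp
qed

theorem theorem3p3:
  fixes E :: "real set" and n :: nat
  assumes "compact E" and "infinite E"
  shows "(\<forall>x0 y0. connected_component (- E) x0 y0 \<longrightarrow>
             dual_residual_poly E x0 n = dual_residual_poly E y0 n) \<and>
         (\<forall>x0. x0 \<in> {..<Inf E} \<union> {Sup E<..} \<longrightarrow>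
             (\<exists>c. c \<noteq> 0 \<and> dual_residual_poly E x0 n = smult c (chebyshev_poly E n))) \<and>
         (\<forall>x0 y0. connected_component (- E) x0 y0 \<longrightarrow>
             poly (residual_poly E x0 n) (complex_of_real y0) \<noteq> 0 \<and>
             (\<forall>x. poly (residual_poly E y0 n) x =
                  poly (residual_poly E x0 n) x / poly (residual_poly E x0 n) (complex_of_real y0)))"
proof -
  have gap: "dual_residual_poly E x n = dual_residual_poly E y n \<and>
      poly (residual_poly E x n) (complex_of_real y) \<noteq> 0 \<and>
      (\<forall>z. poly (residual_poly E y n) z =
         poly (residual_poly E x n) z / poly (residual_poly E x n) (complex_of_real y))"
    if xy: "connected_component (- E) x y" for x y
  proof -
    have x: "x \<notin> E" and y: "y \<notin> E"
      using connected_component_in[OF xy] by auto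
    obtain A R where A: "A \<subseteq> E" "card A = Suc n" and R: "degree R \<le> n" "poly_supnorm E R = 1"
      and sgnx: "\<And>a. a \<in> A \<Longrightarrow> poly R (complex_of_real a) = complex_of_real (sgn (lagrange_basis A a x))"
      by (rule exists_extremal_signature[OF assms x, of n]) (rule that)
    have "sgn (lagrange_basis A a x) = sgn (lagrange_basis A a y)" for a
      unfolding sgn_lagrange_basis
      by (intro arg_cong2[of _ _ _ _ "(*)"] prod.cong refl sgn_diff_connected_component[OF xy])
        (use A in auto)
    then have sgny: "poly R (complex_of_real a) = complex_of_real (sgn (lagrange_basis A a y))"
      if "a \<in> A" for a
      using sgnx[OF that] by simp
    note rx = residual_poly_eq[OF assms(1) A x R sgnx]
    note ry = residual_poly_eq[OF assms(1) A y R sgny]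
    \<comment> \<open>With \<open>A\<close> and \<open>R\<close> shared, the residual polynomial for
      \<open>x\<close> takes at \<open>y\<close> the value
      \<open>lebesgue_function A y / lebesgue_function A x\<close>, which is positive.\<close>
    show ?thesis
      using rx(1) ry(1) by (simp add: rx(2,4) ry(2-4))
  qed
  have outer: "\<exists>c. c \<noteq> 0 \<and> dual_residual_poly E x n = smult c (chebyshev_poly E n)"
    if x: "x \<in> {..<Inf E} \<union> {Sup E<..}" for x
  proof -
    have bdd: "bdd_below E" "bdd_above E"
      using compact_imp_bounded[OF assms(1)] bounded_imp_bdd_below bounded_imp_bdd_above by auto
    \<comment> \<open>All of \<open>E\<close> lies on one side of \<open>x\<close>:
      \<open>\<delta>\<close> is -1 to the left of \<open>E\<close> and 1 to the right.\<close>
    obtain \<delta> :: real where \<delta>: "\<delta> = 1 \<or> \<delta> = -1" "\<And>b. b \<in> E \<Longrightarrow> sgn (x - b) = \<delta>"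
    proof (cases "x < Inf E")
      case True
      then show ?thesis
        using cInf_lower[OF _ bdd(1)] that[of "-1"] by fastforce
    next
      case False
      with x have "Sup E < x"
        by auto
      then show ?thesis
        using cSup_upper[OF _ bdd(2)] that[of 1] by fastforce
    qed
    have xE: "x \<notin> E"
      using \<delta>(2)[of x] \<delta>(1) by auto
    \<comment> \<open>The exponent is \<open>n\<close> because the product for a node
      \<open>a\<close> runs over the \<open>n\<close> other nodes.\<close>
    define s where "s = \<delta> ^ n"
    have s: "s = 1 \<or> s = -1"
      using \<delta>(1) by (cases "even n") (auto simp: s_def)
    obtain A R where A: "A \<subseteq> E" "card A = Suc n" and R: "degree R \<le> n" "poly_supnorm E R = 1"
      and sgnx: "\<And>a. a \<in> A \<Longrightarrow> poly R (complex_of_real a) = complex_of_real (sgn (lagrange_basis A a x))"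
      by (rule exists_extremal_signature[OF assms xE, of n]) (rule that)
    have "sgn (lagrange_basis A a x) = s * sgn (lagrange_lead A a)" if "a \<in> A" for a
    proof -
      have "(\<Prod>b\<in>A-{a}. sgn (x - b)) = (\<Prod>b\<in>A-{a}. \<delta>)"
        by (rule prod.cong) (use A \<delta> in auto)
      then show ?thesis
        using A that by (simp add: sgn_lagrange_basis s_def)
    qed
    with sgnx have sgnl: "poly R (complex_of_real a) = complex_of_real (s * sgn (lagrange_lead A a))"
      if "a \<in> A" for a
      using that by simp
    have "finite A" "A \<noteq> {}"
      using A by (auto simp: card_ge_0_finite)
    then have "(\<Sum>a\<in>A. \<bar>lagrange_lead A a\<bar>) > 0"
      by (intro sum_pos) (auto simp: lagrange_lead_def)
    \<comment> \<open>The constant is the inverse of the factor in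
      \<open>chebyshev_poly_eq\<close>.\<close>
    then show ?thesis
      using residual_poly_eq(4)[OF assms(1) A xE R sgnx]
        chebyshev_poly_eq[OF assms(1) A R s sgnl] s
      by (intro exI[of _ "complex_of_real ((\<Sum>a\<in>A. \<bar>lagrange_lead A a\<bar>) / s)"])
        (auto simp flip: of_real_mult of_real_divide)
  qed
  show ?thesis
    using gap outer by blast
qed

end
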